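(* For all $\beta\in(1,2)$ and integers $n,\Delta$ satisfying $\Delta\le n(2-\beta)/(32\beta)$, every deterministic online streaming algorithm that edge-colors graphs with $n$ vertices and maximum degree $\Delta$ using $\beta\Delta$ colors requires $\Omega((2-\beta)^3 n)$ bits of space.
   Context: An edge coloring assigns colors to edges so that edges sharing an endpoint receive distinct colors. An online streaming algorithm receives the graph as a stream (edges, or vertices together with their edges to previously seen vertices, in adversarial order), must irrevocably output the color of each edge when it arrives, and has a working memory whose size in bits is its space. The maximum degree $\Delta$ is known in advance.
   Formalization: The maximum degree Δ is assumed to be at least 2; for Δ = 0 (no edges) and Δ = 1 (a matching, colored with one color) an algorithm with no memory is correct, so the claimed lower bound fails there. *)

theory Defs
  imports Complex_Main
begin

text \<open>
  Simple graphs on the vertex set \<open>{..<n}\<close>; an edge is a two-element set of vertices.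
\<close>

type_synonym edge = "nat set"

definition simple_graph :: "nat \<Rightarrow> edge set \<Rightarrow> bool" where
  "simple_graph n E \<longleftrightarrow> (\<forall>e\<in>E. e \<subseteq> {..<n} \<and> card e = 2)"

definition degree :: "edge set \<Rightarrow> nat \<Rightarrow> nat" where
  "degree E v = card {e \<in> E. v \<in> e}"

definition max_degree :: "nat \<Rightarrow> edge set \<Rightarrow> nat" where
  "max_degree n E = Max (degree E ` {..<n})"

text \<open>
  A coloring is represented as a set of (edge, color) pairs, which is how it is
  emitted online. For the streams below every edge is emitted exactly once.
\<close>

definition proper_edge_coloring :: "nat \<Rightarrow> (edge \<times> nat) set \<Rightarrow> bool" where
  "proper_edge_coloring k C \<longleftrightarrow>
     (\<forall>(e, c) \<in> C. c \<in> {1..k}) \<and>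
     (\<forall>(e, c) \<in> C. \<forall>(f, d) \<in> C. e \<noteq> f \<and> e \<inter> f \<noteq> {} \<longrightarrow> c \<noteq> d)"

text \<open>
  A deterministic online streaming algorithm: on reading a token it updates its memory, a
  string of bits, and irrevocably emits an output. Only the memory is carried over between
  tokens; the algorithm may otherwise be arbitrary (non-uniform, unbounded time).
\<close>

record ('t, 'r) online_algorithm =
  init :: "bool list"
  step :: "bool list \<Rightarrow> 't \<Rightarrow> bool list \<times> 'r"

definition uses_space :: "('t, 'r) online_algorithm \<Rightarrow> nat \<Rightarrow> bool" where
  "uses_space A s \<longleftrightarrow>
     length (init A) = s \<and>
     (\<forall>m x. length m = s \<longrightarrow> length (fst (step A m x)) = s)"

fun outputs_from :: "('t, 'r) online_algorithm \<Rightarrow> bool list \<Rightarrow> 't list \<Rightarrow> 'r list" where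
  "outputs_from A m [] = []"
| "outputs_from A m (x # xs) = snd (step A m x) # outputs_from A (fst (step A m x)) xs"

definition outputs :: "('t, 'r) online_algorithm \<Rightarrow> 't list \<Rightarrow> 'r list" where
  "outputs A xs = outputs_from A (init A) xs"

text \<open>Edge arrivals: the tokens are the edges, the output is the color of the edge.\<close>

definition edge_stream :: "nat \<Rightarrow> nat \<Rightarrow> edge list \<Rightarrow> bool" where
  "edge_stream n \<Delta> es \<longleftrightarrow>
     distinct es \<and> simple_graph n (set es) \<and> max_degree n (set es) = \<Delta>"

definition edge_arrival_coloring_algorithm ::
    "nat \<Rightarrow> nat \<Rightarrow> nat \<Rightarrow> (edge, nat) online_algorithm \<Rightarrow> bool" where
  "edge_arrival_coloring_algorithm n \<Delta> k A \<longleftrightarrow>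
     (\<forall>es. edge_stream n \<Delta> es \<longrightarrow> proper_edge_coloring k (set (zip es (outputs A es))))"

text \<open>
  Vertex arrivals: a token \<open>(v, N)\<close> is a vertex \<open>v\<close> with the set \<open>N\<close> of its neighbors among
  the vertices seen before; the output is a function whose value at \<open>u \<in> N\<close> is the color of
  the edge \<open>{u, v}\<close> (values outside \<open>N\<close> are ignored).
\<close>

definition vertex_stream_edges :: "(nat \<times> nat set) list \<Rightarrow> edge set" where
  "vertex_stream_edges vs = {{u, v} | u v N. (v, N) \<in> set vs \<and> u \<in> N}"

definition vertex_stream :: "nat \<Rightarrow> nat \<Rightarrow> (nat \<times> nat set) list \<Rightarrow> bool" where
  "vertex_stream n \<Delta> vs \<longleftrightarrow>
     distinct (map fst vs) \<and> set (map fst vs) = {..<n} \<and>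
     (\<forall>i < length vs. snd (vs ! i) \<subseteq> set (map fst (take i vs))) \<and>
     max_degree n (vertex_stream_edges vs) = \<Delta>"

definition vertex_arrival_coloring_algorithm ::
    "nat \<Rightarrow> nat \<Rightarrow> nat \<Rightarrow> (nat \<times> nat set, nat \<Rightarrow> nat) online_algorithm \<Rightarrow> bool" where
  "vertex_arrival_coloring_algorithm n \<Delta> k A \<longleftrightarrow>
     (\<forall>vs. vertex_stream n \<Delta> vs \<longrightarrow>
        proper_edge_coloring k
          {({u, v}, \<chi> u) | u v N \<chi>. ((v, N), \<chi>) \<in> set (zip vs (outputs A vs)) \<and> u \<in> N})"

end

theory Submission
  imports Defs "HOL-Analysis.Convex"
begin

text \<open>
  An edge-arrival algorithm handles vertex arrivals by reading the edges of a token one after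
  the other, so only vertex arrivals matter. Fix a set \<open>U\<close> of vertices and play \<open>\<Delta>\<close> rounds; in each
  round the vertices of \<open>U\<close> are distributed to fresh vertices (centres) of degree at most \<open>\<Delta>\<close>, one
  edge per vertex of \<open>U\<close>, according to a configuration from a large fixed family \<open>F\<close>. Always
  continue with a memory state reached by at least a \<open>2\<^sup>-\<^sup>s\<close> fraction of \<open>F\<close>. The sets of colours that
  \<open>u \<in> U\<close> can receive in the different rounds along this path of states are disjoint, as the
  choices in different rounds can be combined freely. They are subsets of \<open>\<beta>\<Delta>\<close> colours, so in some
  round at least \<open>(2 - \<beta>)|U|\<close> vertices have their colour forced by the two memory states. A
  configuration of the popular class of that round never sends two vertices with the same forced
  colour to the same centre. If the centres come in gadgets of \<open>R \<approx> 8/(2 - \<beta>)\<close> centres, each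
  gadget being filled by a bijection onto its \<open>R\<Delta>\<close> places, there are \<open>\<Omega>(\<Delta>)\<close> disjoint pairs of
  equal forced colour per gadget, and each of them collides with probability at least \<open>1/(4R)\<close> even
  after conditioning on the places of the previous ones; hence \<open>s\<close> is at least of order
  \<open>|U|/R\<^sup>2\<close>.
\<close>


subsection \<open>Counting injections that separate equal colours\<close>

definition injections :: "'a set \<Rightarrow> 'b set \<Rightarrow> ('a \<Rightarrow> 'b) set" where
  "injections X Y = {f \<in> X \<rightarrow>\<^sub>E Y. inj_on f X}"

lemma finite_injections: "finite X \<Longrightarrow> finite Y \<Longrightarrow> finite (injections X Y)"
  unfolding injections_def by (rule finite_subset[of _ "X \<rightarrow>\<^sub>E Y"]) (auto intro: finite_PiE)

lemma card_injections:
  assumes "finite X" "finite Y" "card X = card Y"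
  shows "card (injections X Y) = fact (card Y)"
  using card_inj_on_subset_funcset[OF assms(1,2) subset_refl] assms(3)
  by (simp add: injections_def fact_prod_rev)

text \<open>\<open>p\<close> stands for the map from a place to its centre and \<open>W\<close> for
  the vertices whose colour \<open>col\<close> is forced. Equal forced colours at one centre would
  conflict there, so only separating fillings of a gadget can occur in a popular class.\<close>

definition separating ::
    "('b \<Rightarrow> 'd) \<Rightarrow> 'a set \<Rightarrow> ('a \<Rightarrow> 'c) \<Rightarrow> 'a set \<Rightarrow> 'b set \<Rightarrow> ('a \<Rightarrow> 'b) set" where
  "separating p W col X Y =
     {f \<in> injections X Y. \<forall>w\<in>W. \<forall>w'\<in>W. w \<noteq> w' \<and> col w = col w' \<longrightarrow> p (f w) \<noteq> p (f w')}"

text \<open>Cauchy-Schwarz on the fibre sizes: at least a \<open>1 / card B\<close> fraction of the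
  ordered pairs, diagonal included, falls into a common fibre.\<close>

lemma card_pairs_distinct_fibres:
  assumes "finite Y" "p ` Y \<subseteq> B" "finite B"
  shows "real (card B) * real (card {(y, y') \<in> Y \<times> Y. p y \<noteq> p y'})
           \<le> (real (card B) - 1) * (real (card Y))\<^sup>2"
proof -
  define F where "F b = {y \<in> Y. p y = b}" for b
  let ?E = "{(y, y') \<in> Y \<times> Y. p y = p y'}" and ?N = "{(y, y') \<in> Y \<times> Y. p y \<noteq> p y'}"
  have fin: "finite (F b)" for b
    unfolding F_def using assms(1) by auto
  have "Y = (\<Union>b\<in>B. F b)"
    unfolding F_def using assms(2) by auto
  moreover have "card (\<Union>b\<in>B. F b) = (\<Sum>b\<in>B. card (F b))"
    by (rule card_UN_disjoint) (use assms fin in \<open>auto simp: F_def\<close>)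
  ultimately have Y: "card Y = (\<Sum>b\<in>B. card (F b))" by simp
  have "?E = (\<Union>b\<in>B. F b \<times> F b)"
    unfolding F_def using assms(2) by auto
  moreover have "card (\<Union>b\<in>B. F b \<times> F b) = (\<Sum>b\<in>B. card (F b \<times> F b))"
    by (rule card_UN_disjoint) (use assms fin in \<open>auto simp: F_def\<close>)
  ultimately have E: "real (card ?E) = (\<Sum>b\<in>B. (real (card (F b)))\<^sup>2)"
    by (simp add: card_cartesian_product power2_eq_square)
  have "(real (card Y))\<^sup>2 \<le> real (card ?E) * real (card B)"
    using sum_squared_le_sum_of_squares[of "\<lambda>b. real (card (F b))" B] Y E by simp
  moreover have "card (Y \<times> Y) = card ?E + card ?N"
  proof -
    have "Y \<times> Y = ?E \<union> ?N" by auto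
    then have "card (Y \<times> Y) = card (?E \<union> ?N)" by (rule arg_cong)
    also have "\<dots> = card ?E + card ?N"
      by (rule card_Un_disjoint) (use assms(1) in \<open>auto intro: finite_subset[of _ "Y \<times> Y"]\<close>)
    finally show ?thesis .
  qed
  then have "real (card ?N) = (real (card Y))\<^sup>2 - real (card ?E)"
    by (simp add: card_cartesian_product power2_eq_square flip: of_nat_mult)
  ultimately have "real (card B) * real (card ?N) = real (card B) * (real (card Y))\<^sup>2 - real (card B) * real (card ?E)"
      "(real (card Y))\<^sup>2 \<le> real (card B) * real (card ?E)"
    by (simp_all only: right_diff_distrib mult.commute)
  then show ?thesis
    by (simp only: left_diff_distrib)
qed

text \<open>
  The last hypothesis keeps \<open>4 |B| \<le> 3 |Y|\<close> through the \<open>t\<close> steps; under that bound Cauchy-Schwarz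
  makes at least a \<open>1/(4|B|)\<close> fraction of the ordered pairs of distinct places collide.
\<close>
lemma card_separating_le:
  assumes "finite X" "finite Y" "card X = card Y" "W \<subseteq> X" "col ` W \<subseteq> K" "finite K"
    and "p ` Y \<subseteq> B" "finite B" "B \<noteq> {}"
    and "t > 0 \<Longrightarrow> card K + 2 * t \<le> card W" "4 * card B + 6 * t \<le> 3 * card Y + 6"
  shows "real (card (separating p W col X Y)) \<le> (1 - 1 / (4 * real (card B))) ^ t * fact (card Y)"
  using assms
proof (induction t arbitrary: X Y W)
  case 0
  then have "card (separating p W col X Y) \<le> card (injections X Y)"
    by (intro card_mono finite_injections) (auto simp: separating_def)
  then have "card (separating p W col X Y) \<le> fact (card Y)"
    using 0 card_injections by metis
  then have "real (card (separating p W col X Y)) \<le> real (fact (card Y))"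
    by (rule of_nat_mono)
  then show ?case by simp
next
  case (Suc t)
  define R where "R = card B"
  define N where "N = card Y"
  define q where "q = 1 - 1 / (4 * real R)"
  have R: "R > 0" using Suc.prems by (simp add: R_def card_gt_0_iff)
  have "q \<ge> 0" using R by (simp add: q_def)
  have "finite W" using Suc.prems finite_subset by blast
  \<comment> \<open>More vertices in \<open>W\<close> than colours, so two of them share a colour.
    Removing the pair costs \<open>W\<close> two elements, which the term \<open>2 * t\<close> pays
    for.\<close>
  have "card W > card K" using Suc.prems by auto
  then have "\<not> inj_on col W"
    using card_inj_on_le[OF _ \<open>col ` W \<subseteq> K\<close> \<open>finite K\<close>] by auto
  then obtain w w' where w: "w \<in> W" "w' \<in> W" "w \<noteq> w'" "col w = col w'"
    by (auto simp: inj_on_def)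
  define X' where "X' = X - {w, w'}"
  define W' where "W' = W - {w, w'}"
  define NC where "NC = {(y, y') \<in> Y \<times> Y. p y \<noteq> p y'}"
  \<comment> \<open>Once the places \<open>z\<close> of the pair are fixed, the other vertices must
    be separated on the remaining places; the induction hypothesis bounds this whatever
    \<open>z\<close> is.\<close>
  define T where "T = (\<lambda>z. separating p W' col X' (Y - {fst z, snd z}))"
  have "finite NC" unfolding NC_def
    using Suc.prems by (auto intro: finite_subset[of _ "Y \<times> Y"])
  have wX: "w \<in> X" "w' \<in> X" using w Suc.prems by auto
  have N2: "N \<ge> 2" using R Suc.prems by (auto simp: N_def R_def)
  have card_W': "card W' = card W - 2" and card_X': "card X' = N - 2"
    using w wX \<open>finite W\<close> Suc.prems by (auto simp: W'_def X'_def N_def card_Diff_subset)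
  have T: "real (card (T z)) \<le> q ^ t * fact (N - 2)" if "z \<in> NC" for z
  proof -
    have z: "fst z \<in> Y" "snd z \<in> Y" "fst z \<noteq> snd z" using that by (auto simp: NC_def)
    then have c: "card (Y - {fst z, snd z}) = N - 2"
      using Suc.prems by (simp add: N_def card_Diff_subset)
    show ?thesis
      unfolding T_def q_def R_def c[symmetric]
      by (rule Suc.IH) (use Suc.prems c card_X' card_W' in \<open>auto simp: X'_def W'_def N_def\<close>)
  qed
  have finT: "finite (T z)" for z
    unfolding T_def separating_def using Suc.prems
    by (auto simp: X'_def intro!: finite_subset[OF _ finite_injections[of X' "Y - {fst z, snd z}"]])
  have NC: "real (card NC) \<le> q * (real N * (real N - 1))"
  proof -
    have "real R * real (card NC) \<le> (real R - 1) * (real N)\<^sup>2"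
      using card_pairs_distinct_fibres[of Y p B] Suc.prems by (simp add: NC_def R_def N_def)
    \<comment> \<open>The diagonal pairs must be discarded, which is paid for by weakening the
      collision fraction from \<open>1 / R\<close> to \<open>1 / (4 * R)\<close>.\<close>
    also have "\<dots> \<le> real R * (q * (real N * (real N - 1)))"
    proof -
      have "4 * R \<le> 3 * N" using Suc.prems by (simp add: R_def N_def)
      then have "4 * real R \<le> 3 * real N" by linarith
      then have "0 \<le> real N * (3 * real N - 4 * real R + 1)"
        by (intro mult_nonneg_nonneg) auto
      moreover have "real R * (q * (real N * (real N - 1))) - (real R - 1) * (real N)\<^sup>2 =
            real N * (3 * real N - 4 * real R + 1) / 4"
        using R by (simp add: q_def field_simps power2_eq_square)
      ultimately show ?thesis by linarith
    qed
    finally show ?thesis using R by simp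
  qed
  \<comment> \<open>A separating injection is determined by the images of \<open>w\<close> and
    \<open>w'\<close> and by its restriction to \<open>X'\<close>.\<close>
  have "card (separating p W col X Y) \<le> card (Sigma NC T)"
  proof (rule card_inj_on_le[where f = "\<lambda>f. ((f w, f w'), restrict f X')"])
    show "inj_on (\<lambda>f. ((f w, f w'), restrict f X')) (separating p W col X Y)"
    proof (rule inj_onI)
      fix f g
      assume f: "f \<in> separating p W col X Y" and g: "g \<in> separating p W col X Y"
        and eq: "((f w, f w'), restrict f X') = ((g w, g w'), restrict g X')"
      have "f x = g x" if "x \<in> X" for x
        using eq that by (cases "x \<in> X'") (auto simp: X'_def fun_eq_iff restrict_def split: if_splits)
      then show "f = g"
        using f g unfolding separating_def injections_def by (auto intro: PiE_ext)
    qed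
    show "(\<lambda>f. ((f w, f w'), restrict f X')) ` separating p W col X Y \<subseteq> Sigma NC T"
    proof (rule image_subsetI)
      fix f assume f: "f \<in> separating p W col X Y"
      then have inj: "inj_on f X" and fY: "\<And>x. x \<in> X \<Longrightarrow> f x \<in> Y"
        and sep: "\<And>v v'. v \<in> W \<Longrightarrow> v' \<in> W \<Longrightarrow> v \<noteq> v' \<Longrightarrow> col v = col v' \<Longrightarrow> p (f v) \<noteq> p (f v')"
        by (auto simp: separating_def injections_def)
      have "(f w, f w') \<in> NC" using sep[OF w] fY wX by (auto simp: NC_def)
      moreover have "restrict f X' \<in> T (f w, f w')"
        unfolding T_def separating_def injections_def
        using inj fY sep wX Suc.prems(4)
        by (auto simp: X'_def W'_def inj_on_def)
      ultimately show "((f w, f w'), restrict f X') \<in> Sigma NC T" by simp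
    qed
    show "finite (Sigma NC T)" using \<open>finite NC\<close> finT by (rule finite_SigmaI)
  qed
  also have "card (Sigma NC T) = (\<Sum>z\<in>NC. card (T z))"
    using \<open>finite NC\<close> finT by (simp add: card_SigmaI)
  finally have "card (separating p W col X Y) \<le> (\<Sum>z\<in>NC. card (T z))" .
  then have "real (card (separating p W col X Y)) \<le> (\<Sum>z\<in>NC. real (card (T z)))"
    by (simp flip: of_nat_sum)
  also have "\<dots> \<le> real (card NC) * (q ^ t * fact (N - 2))"
    by (rule sum_bounded_above) (rule T)
  also have "\<dots> \<le> q * (real N * (real N - 1)) * (q ^ t * fact (N - 2))"
    by (rule mult_right_mono[OF NC]) (use \<open>q \<ge> 0\<close> in simp)
  also have "\<dots> = q ^ Suc t * fact N"
  proof -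
    have "N = Suc (Suc (N - 2))" using N2 by simp
    then obtain m where "N = Suc (Suc m)" by blast
    then have "(fact N :: real) = real N * (real N - 1) * fact (N - 2)"
      by (simp add: algebra_simps)
    then show ?thesis by simp
  qed
  finally show ?case
    by (simp add: q_def R_def N_def)
qed

subsection \<open>Runs of an algorithm and streams made of rounds\<close>

lemma div_mult_add_less: "r < q \<Longrightarrow> (i * q + r) div q = (i :: nat)"
  by (cases "q = 0") auto

lemma mod_mult_add_less: "r < q \<Longrightarrow> (i * q + r) mod q = (r :: nat)"
  by simp

definition mem_after :: "('t, 'r) online_algorithm \<Rightarrow> bool list \<Rightarrow> 't list \<Rightarrow> bool list" where
  "mem_after A m xs = foldl (\<lambda>m x. fst (step A m x)) m xs"

lemma mem_after_simps [simp]: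
  "mem_after A m [] = m"
  "mem_after A m (x # xs) = mem_after A (fst (step A m x)) xs"
  "mem_after A m (xs @ ys) = mem_after A (mem_after A m xs) ys"
  by (simp_all add: mem_after_def)

lemma outputs_from_append:
  "outputs_from A m (xs @ ys) = outputs_from A m xs @ outputs_from A (mem_after A m xs) ys"
  by (induction xs arbitrary: m) auto

lemma length_outputs_from [simp]: "length (outputs_from A m xs) = length xs"
  by (induction xs arbitrary: m) auto

lemma length_mem_after:
  "uses_space A s \<Longrightarrow> length m = s \<Longrightarrow> length (mem_after A m xs) = s"
  by (induction xs arbitrary: m) (auto simp: uses_space_def)

text \<open>The outputs on a block depend only on the block and the state before it. Blocks that
  lead along the same states \<open>ms\<close> can therefore be exchanged independently of one
  another.\<close>

lemma outputs_from_concat: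
  assumes "\<And>i. i < D \<Longrightarrow> mem_after A (ms i) (B i) = ms (Suc i)"
  shows "mem_after A (ms 0) (concat (map B [0..<D])) = ms D \<and>
    (\<forall>i<D. set (zip (B i) (outputs_from A (ms i) (B i)))
      \<subseteq> set (zip (concat (map B [0..<D])) (outputs_from A (ms 0) (concat (map B [0..<D])))))"
  using assms
proof (induction D)
  case (Suc D)
  then show ?case by (auto simp: outputs_from_append less_Suc_eq)
qed simp

text \<open>The vertices below \<open>a\<close> are used again in every round, while round
  \<open>i\<close> owns the fresh centres \<open>a + i * q + j\<close>. Token \<open>j\<close> of
  the round is centre \<open>j\<close>, so \<open>f u\<close> is also the index of the token that
  brings the edge at \<open>u\<close>.\<close>

definition round_tokens :: "nat \<Rightarrow> nat \<Rightarrow> nat \<Rightarrow> (nat \<Rightarrow> nat) \<Rightarrow> (nat \<times> nat set) list" where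
  "round_tokens a q i f = map (\<lambda>j. (a + i * q + j, {u. u < a \<and> f u = j})) [0..<q]"

lemma length_round_tokens: "length (round_tokens a q i f) = q"
  by (simp add: round_tokens_def)

text \<open>A stream has to contain all \<open>n\<close> vertices. Those below \<open>a\<close> come
  first because every round refers back to them; those from \<open>b\<close> on are padding.\<close>

definition isolated_tokens :: "nat \<Rightarrow> nat \<Rightarrow> nat \<Rightarrow> (nat \<times> nat set) list" where
  "isolated_tokens a b n = map (\<lambda>v. (v, {})) ([0..<a] @ [b..<n])"

definition rounds :: "nat \<Rightarrow> nat \<Rightarrow> nat \<Rightarrow> (nat \<Rightarrow> nat \<Rightarrow> nat) \<Rightarrow> (nat \<times> nat set) list" where
  "rounds a q D X = concat (map (\<lambda>i. round_tokens a q i (X i)) [0..<D])"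

definition star_packing :: "nat \<Rightarrow> nat \<Rightarrow> nat \<Rightarrow> (nat \<Rightarrow> nat) \<Rightarrow> bool" where
  "star_packing a q D f \<longleftrightarrow> (\<forall>u<a. f u < q) \<and> (\<forall>j. card {u. u < a \<and> f u = j} \<le> D)"

lemma map_fst_rounds: "map fst (rounds a q D X) = [a..<a + D * q]"
proof (induction D)
  case (Suc D)
  have "map fst (round_tokens a q D (X D)) = map (\<lambda>j. j + (a + D * q)) [0..<q]"
    by (simp add: round_tokens_def comp_def add.commute)
  also have "\<dots> = [a + D * q..<a + D * q + q]"
    by (simp only: map_add_upt add_0 add.commute)
  finally show ?case
    using Suc upt_add_eq_append[of a "a + D * q" q]
    by (simp add: rounds_def add.commute add.left_commute)
qed (simp add: rounds_def)

lemma set_rounds: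
  "set (rounds a q D X) = {(a + i * q + j, {u. u < a \<and> X i u = j}) | i j. i < D \<and> j < q}"
  by (auto simp: rounds_def round_tokens_def) blast

lemma vertex_stream_edges_rounds:
  assumes "\<And>i. i < D \<Longrightarrow> star_packing a q D (X i)"
  shows "vertex_stream_edges (isolated_tokens a b n @ rounds a q D X) =
           {{u, a + i * q + X i u} | u i. u < a \<and> i < D}"
proof (intro equalityI subsetI)
  fix e assume "e \<in> vertex_stream_edges (isolated_tokens a b n @ rounds a q D X)"
  then obtain u v N where e: "e = {u, v}" "u \<in> N"
      and "(v, N) \<in> set (isolated_tokens a b n @ rounds a q D X)"
    by (auto simp: vertex_stream_edges_def)
  then have "(v, N) \<in> set (rounds a q D X)"
    by (auto simp: isolated_tokens_def)
  then obtain i j where "v = a + i * q + j" "N = {u. u < a \<and> X i u = j}" "i < D"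
    by (auto simp: set_rounds)
  with e show "e \<in> {{u, a + i * q + X i u} | u i. u < a \<and> i < D}"
    by blast
next
  fix e assume "e \<in> {{u, a + i * q + X i u} | u i. u < a \<and> i < D}"
  then obtain u i where e: "e = {u, a + i * q + X i u}" "u < a" "i < D" by blast
  then have "(a + i * q + X i u, {u'. u' < a \<and> X i u' = X i u}) \<in> set (rounds a q D X)"
    using assms by (auto simp: set_rounds star_packing_def)
  with e show "e \<in> vertex_stream_edges (isolated_tokens a b n @ rounds a q D X)"
    unfolding vertex_stream_edges_def by fastforce
qed

text \<open>A vertex below \<open>a\<close> gets one edge to a new centre in each of the
  \<open>D\<close> rounds, hence degree exactly \<open>D\<close>. A centre meets edges of its own
  round only, at most \<open>D\<close> by the packing condition.\<close>

lemma max_degree_rounds: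
  assumes X: "\<And>i. i < D \<Longrightarrow> star_packing a q D (X i)" and "0 < a" "a \<le> n"
  shows "max_degree n {{u, a + i * q + X i u} | u i. u < a \<and> i < D} = D"
proof -
  define E where "E = {{u, a + i * q + X i u} | u i. u < a \<and> i < D}"
  have Xq: "X i u < q" if "u < a" "i < D" for u i
    using X that by (auto simp: star_packing_def)
  have low: "degree E u = D" if u: "u < a" for u
  proof -
    have "{e \<in> E. u \<in> e} = (\<lambda>i. {u, a + i * q + X i u}) ` {..<D}"
      using u by (auto simp: E_def)
    moreover have "inj_on (\<lambda>i. {u, a + i * q + X i u}) {..<D}"
    proof (rule inj_onI)
      fix i j assume ij: "i \<in> {..<D}" "j \<in> {..<D}"
        and eq: "{u, a + i * q + X i u} = {u, a + j * q + X j u}"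
      from eq have "i * q + X i u = j * q + X j u"
        using u by (auto simp: doubleton_eq_iff)
      then have "(i * q + X i u) div q = (j * q + X j u) div q" by simp
      then show "i = j" using Xq[OF u] ij by (simp add: div_mult_add_less)
    qed
    ultimately show ?thesis by (simp add: degree_def card_image)
  qed
  have high: "degree E v \<le> D" if v: "\<not> v < a" for v
  proof (cases "{e \<in> E. v \<in> e} = {}")
    case True
    then show ?thesis by (simp only: degree_def card.empty)
  next
    case False
    define i where "i = (v - a) div q"
    define j where "j = (v - a) mod q"
    have "i' = i \<and> X i' u = j" if "u < a" "i' < D" "v = a + i' * q + X i' u" for u i'
      using Xq[OF that(1,2)] that(3) by (simp add: i_def j_def div_mult_add_less add.assoc)
    then have sub: "{e \<in> E. v \<in> e} \<subseteq> (\<lambda>u. {u, v}) ` {u. u < a \<and> X i u = j}" and "i < D"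
      using False v by (auto simp: E_def)
    have "card {e \<in> E. v \<in> e} \<le> card {u. u < a \<and> X i u = j}"
      by (rule order_trans[OF card_mono[OF _ sub] card_image_le]) auto
    also have "\<dots> \<le> D" using X[OF \<open>i < D\<close>] by (auto simp: star_packing_def)
    finally show ?thesis by (simp add: degree_def)
  qed
  have "Max (degree E ` {..<n}) = D"
  proof (rule Max_eqI)
    show "y \<le> D" if "y \<in> degree E ` {..<n}" for y
      using that low high by (metis imageE order_refl)
    show "D \<in> degree E ` {..<n}"
      using low[OF \<open>0 < a\<close>] assms(2,3) by (intro image_eqI[of _ _ 0]) auto
  qed simp
  then show ?thesis by (simp add: max_degree_def E_def)
qed

lemma vertex_stream_rounds:
  assumes X: "\<And>i. i < D \<Longrightarrow> star_packing a q D (X i)" and "0 < a" "a + D * q \<le> n"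
  shows "vertex_stream n D (isolated_tokens a (a + D * q) n @ rounds a q D X)"
proof -
  let ?pre = "isolated_tokens a (a + D * q) n" and ?rs = "rounds a q D X"
  have pre: "map fst ?pre = [0..<a] @ [a + D * q..<n]"
    by (simp add: isolated_tokens_def comp_def)
  have "snd ((?pre @ ?rs) ! i) \<subseteq> set (map fst (take i (?pre @ ?rs)))"
    if i: "i < length (?pre @ ?rs)" for i
  proof (cases "i < length ?pre")
    case True
    then have "snd ((?pre @ ?rs) ! i) = {}"
      by (simp add: nth_append isolated_tokens_def del: upt_Suc map_append)
    then show ?thesis by simp
  next
    case False
    then have "(?pre @ ?rs) ! i \<in> set ?rs" using i by (simp add: nth_append)
    then have "snd ((?pre @ ?rs) ! i) \<subseteq> {..<a}" by (auto simp: set_rounds)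
    also have "\<dots> \<subseteq> set (map fst ?pre)" unfolding pre by auto
    also have "\<dots> \<subseteq> set (map fst (take i (?pre @ ?rs)))" using False by auto
    finally show ?thesis .
  qed
  moreover have "distinct (map fst (?pre @ ?rs))" "set (map fst (?pre @ ?rs)) = {..<n}"
    using assms(3) unfolding map_append pre map_fst_rounds by auto
  moreover have "max_degree n (vertex_stream_edges (?pre @ ?rs)) = D"
    using max_degree_rounds[of D a q X n] vertex_stream_edges_rounds[of D a q X "a + D * q" n] assms by simp
  ultimately show ?thesis unfolding vertex_stream_def by blast
qed

lemma proper_edge_coloringD:
  assumes "proper_edge_coloring k C" "(e, c) \<in> C" "(f, d) \<in> C"
  shows "c \<in> {1..k} \<and> (e \<noteq> f \<longrightarrow> e \<inter> f \<noteq> {} \<longrightarrow> c \<noteq> d)"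
  using assms unfolding proper_edge_coloring_def by blast

section \<open>Popular memory states and the colours they force\<close>

lemma popular_value:
  assumes "finite F" "\<And>x. x \<in> F \<Longrightarrow> length (h x :: bool list) = s"
  shows "\<exists>m. length m = s \<and> card F \<le> 2 ^ s * card {x \<in> F. h x = m}"
proof -
  let ?B = "{m :: bool list. length m = s}"
  have B: "finite ?B" "card ?B = 2 ^ s"
    using finite_lists_length_eq[of "UNIV :: bool set" s] card_lists_length_eq[of "UNIV :: bool set" s]
    by simp_all
  have "replicate s True \<in> ?B" by simp
  then obtain m where "m \<in> ?B" "card F \<le> card (h -` {m} \<inter> F) * card ?B"
    using pigeonhole_card[of h F ?B] assms B by blast
  moreover have "h -` {m} \<inter> F = {x \<in> F. h x = m}" by auto
  ultimately show ?thesis using B by (auto simp: mult.commute)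
qed

text \<open>The colour sets of a vertex in the \<open>D\<close> rounds are disjoint subsets of
  \<open>k\<close> colours, so in some round their sizes sum to at most \<open>k * a / D\<close>
  over all vertices. The inequality obtained says that \<open>W\<close> contains at least a
  \<open>2 - k / D\<close> fraction of the \<open>a\<close> vertices, written without
  division.\<close>

lemma popular_class_with_forced_colours:
  fixes conf :: "'x \<Rightarrow> nat \<Rightarrow> nat"
  assumes alg: "vertex_arrival_coloring_algorithm n D k A" and space: "uses_space A s"
    and F: "finite F" "F \<noteq> {}" "\<And>x. x \<in> F \<Longrightarrow> star_packing a q D (conf x)"
    and n: "a + D * q \<le> n" "0 < a" "0 < D"
  obtains C W col where "C \<subseteq> F" "card F \<le> 2 ^ s * card C" "W \<subseteq> {..<a}" "col ` W \<subseteq> {1..k}"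
    "2 * D * a \<le> D * card W + k * a"
    "\<And>x w w'. x \<in> C \<Longrightarrow> w \<in> W \<Longrightarrow> w' \<in> W \<Longrightarrow> w \<noteq> w' \<Longrightarrow> col w = col w' \<Longrightarrow> conf x w \<noteq> conf x w'"
proof -
  let ?pre = "isolated_tokens a (a + D * q) n"
  define m0 where "m0 = mem_after A (init A) ?pre"
  define cls where "cls i m m' = {x \<in> F. mem_after A m (round_tokens a q i (conf x)) = m'}" for i :: nat and m m'
  have "length m0 = s"
    using space by (auto simp: m0_def uses_space_def intro: length_mem_after)
  \<comment> \<open>Dependent choice of the path of popular states; the conjunct about
    \<open>i = 0\<close> pins its start to \<open>m0\<close>.\<close>
  then have "\<exists>ms. \<forall>i. (length (ms i) = s \<and> (i = 0 \<longrightarrow> ms i = m0)) \<and>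
      card F \<le> 2 ^ s * card (cls i (ms i) (ms (Suc i)))"
  proof (intro dependent_nat_choice)
    fix m and i :: nat
    assume "length m = s \<and> (i = 0 \<longrightarrow> m = m0)"
    then obtain m' where "length m' = s" "card F \<le> 2 ^ s * card (cls i m m')"
      unfolding cls_def
      using popular_value[OF F(1), of "\<lambda>x. mem_after A m (round_tokens a q i (conf x))" s]
        length_mem_after[OF space] by blast
    then show "\<exists>m'. (length m' = s \<and> (Suc i = 0 \<longrightarrow> m' = m0)) \<and> card F \<le> 2 ^ s * card (cls i m m')"
      by auto
  qed auto
  then obtain ms where ms0: "ms 0 = m0"
    and ms: "\<And>i. card F \<le> 2 ^ s * card (cls i (ms i) (ms (Suc i)))"
    by blast
  define C where "C i = cls i (ms i) (ms (Suc i))" for i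
  have CF: "C i \<subseteq> F" for i by (auto simp: C_def cls_def)
  have "card F > 0" using F by (simp add: card_gt_0_iff)
  then have "C i \<noteq> {}" for i
    using ms[of i] unfolding C_def by (metis card.empty less_le_not_le mult_0_right)
  then have "\<forall>i. \<exists>x. x \<in> C i" by auto
  \<comment> \<open>\<open>rep\<close> fills the rounds that are not being compared.\<close>
  then obtain rep where rep: "\<And>i. rep i \<in> C i" by metis
  define clr where
    "clr i x u = (outputs_from A (ms i) (round_tokens a q i (conf x)) ! conf x u) u" for i x u
  \<comment> \<open>Any choice of one member from each class gives a valid stream with the same
    states \<open>ms\<close> at the round boundaries. Colours of different rounds can thus be
    compared inside a single proper colouring.\<close>
  have consistent: "clr i (X i) u \<in> {1..k} \<and>
      ({u, a + i * q + conf (X i) u} \<noteq> {u', a + i' * q + conf (X i') u'} \<longrightarrow>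
       {u, a + i * q + conf (X i) u} \<inter> {u', a + i' * q + conf (X i') u'} \<noteq> {} \<longrightarrow>
       clr i (X i) u \<noteq> clr i' (X i') u')"
    if X: "\<And>i. X i \<in> C i" and i: "i < D" "i' < D" and u: "u < a" "u' < a" for X i i' u u'
  proof -
    let ?rs = "rounds a q D (\<lambda>i. conf (X i))"
    let ?col = "{({u, v}, \<chi> u) | u v N \<chi>. ((v, N), \<chi>) \<in> set (zip (?pre @ ?rs) (outputs A (?pre @ ?rs))) \<and> u \<in> N}"
    have pack: "star_packing a q D (conf (X i))" for i using F(3) X CF by blast
    then have "vertex_stream n D (?pre @ ?rs)"
      by (intro vertex_stream_rounds) (use n in auto)
    then have proper: "proper_edge_coloring k ?col"
      using alg by (auto simp: vertex_arrival_coloring_algorithm_def)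
    have mem: "({u, a + i * q + conf (X i) u}, clr i (X i) u) \<in> ?col" if "i < D" "u < a" for i u
    proof -
      let ?T = "round_tokens a q i (conf (X i))"
      let ?j = "conf (X i) u"
      have j: "?j < q" using pack[of i] that by (auto simp: star_packing_def)
      have "set (zip ?T (outputs_from A (ms i) ?T)) \<subseteq> set (zip ?rs (outputs_from A (ms 0) ?rs))"
        unfolding rounds_def
        using outputs_from_concat[of D A ms "\<lambda>i. round_tokens a q i (conf (X i))"] X that(1)
        by (auto simp: C_def cls_def)
      moreover have "(?T ! ?j, outputs_from A (ms i) ?T ! ?j) \<in> set (zip ?T (outputs_from A (ms i) ?T))"
        using j nth_mem[of ?j "zip ?T (outputs_from A (ms i) ?T)"] by (simp add: length_round_tokens)
      moreover have "?T ! ?j = (a + i * q + ?j, {u'. u' < a \<and> conf (X i) u' = ?j})"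
        using j by (simp add: round_tokens_def)
      ultimately have "((a + i * q + ?j, {u'. u' < a \<and> conf (X i) u' = ?j}), outputs_from A (ms i) ?T ! ?j)
          \<in> set (zip (?pre @ ?rs) (outputs A (?pre @ ?rs)))"
        by (auto simp: outputs_def outputs_from_append ms0 m0_def)
      then show ?thesis
        unfolding clr_def using that(2) by blast
    qed
    show ?thesis
      by (rule proper_edge_coloringD[OF proper mem[OF i(1) u(1)] mem[OF i(2) u(2)]])
  qed
  define S where "S i u = (\<lambda>x. clr i x u) ` C i" for i u
  have clr_range: "clr i x u \<in> {1..k}" if "x \<in> C i" "i < D" "u < a" for i x u
  proof -
    have "(rep(i := x)) j \<in> C j" for j using that(1) rep by simp
    from consistent[OF this that(2,2,3,3)] show ?thesis by simp
  qed
  \<comment> \<open>The two edges meet in \<open>u\<close> and lead to centres of different rounds;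
    one stream realises both choices \<open>x\<close> and \<open>x'\<close>.\<close>
  have clr_rounds: "clr i x u \<noteq> clr i' x' u"
    if "x \<in> C i" "x' \<in> C i'" "i \<noteq> i'" "i < D" "i' < D" "u < a" for i i' x x' u
  proof -
    have "conf x u < q" "conf x' u < q"
      using F(3) CF that by (auto simp: star_packing_def subset_iff)
    have "a + i * q + conf x u \<noteq> a + i' * q + conf x' u"
    proof
      assume "a + i * q + conf x u = a + i' * q + conf x' u"
      then have "(i * q + conf x u) div q = (i' * q + conf x' u) div q" by simp
      then show False
        using \<open>conf x u < q\<close> \<open>conf x' u < q\<close> \<open>i \<noteq> i'\<close> by (simp add: div_mult_add_less)
    qed
    then have "{u, a + i * q + conf x u} \<noteq> {u, a + i' * q + conf x' u}"
      by (auto simp: doubleton_eq_iff)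
    moreover have "(rep(i := x, i' := x')) j \<in> C j" for j using that(1,2) rep by simp
    from consistent[OF this that(4,5,6,6)]
    have "{u, a + i * q + conf x u} \<noteq> {u, a + i' * q + conf x' u} \<longrightarrow> clr i x u \<noteq> clr i' x' u"
      using that(3) by simp
    ultimately show ?thesis by blast
  qed
  have clr_star: "clr i x u \<noteq> clr i x u'"
    if "x \<in> C i" "i < D" "u < a" "u' < a" "u \<noteq> u'" "conf x u = conf x u'" for i x u u'
  proof -
    have "{u, a + i * q + conf x u} \<noteq> {u', a + i * q + conf x u'}"
      using that(3-5) by (auto simp: doubleton_eq_iff)
    moreover have "{u, a + i * q + conf x u} \<inter> {u', a + i * q + conf x u'} \<noteq> {}"
      using that(6) by auto
    moreover have "(rep(i := x)) j \<in> C j" for j using that(1) rep by simp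
    from consistent[OF this that(2,2,3,4)]
    have "{u, a + i * q + conf x u} \<noteq> {u', a + i * q + conf x u'} \<longrightarrow>
        {u, a + i * q + conf x u} \<inter> {u', a + i * q + conf x u'} \<noteq> {} \<longrightarrow> clr i x u \<noteq> clr i x u'"
      unfolding fun_upd_same by (rule conjunct2)
    ultimately show ?thesis by blast
  qed
  have finC: "finite (C i)" for i using CF F(1) finite_subset by blast
  have "(\<Sum>i<D. card (S i u)) \<le> k" if u: "u < a" for u
  proof -
    have "(\<Sum>i<D. card (S i u)) = card (\<Union>i<D. S i u)"
      by (rule card_UN_disjoint[symmetric]) (use finC clr_rounds u in \<open>auto simp: S_def\<close>)
    also have "\<dots> \<le> card {1..k}"
      by (rule card_mono) (use clr_range u in \<open>auto simp: S_def\<close>)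
    finally show ?thesis by simp
  qed
  then have "(\<Sum>u<a. \<Sum>i<D. card (S i u)) \<le> a * k"
    using sum_bounded_above[of "{..<a}" "\<lambda>u. \<Sum>i<D. card (S i u)" k] by simp
  then have total: "(\<Sum>i<D. \<Sum>u<a. card (S i u)) \<le> k * a"
    by (subst sum.swap) (simp add: mult.commute)
  have "\<exists>i<D. D * (\<Sum>u<a. card (S i u)) \<le> k * a"
  proof (rule ccontr)
    assume "\<not> ?thesis"
    then have "(\<Sum>i<D. k * a) < (\<Sum>i<D. D * (\<Sum>u<a. card (S i u)))"
      using n(3) by (intro sum_strict_mono) auto
    also have "\<dots> = D * (\<Sum>i<D. \<Sum>u<a. card (S i u))"
      by (simp add: sum_distrib_left)
    finally show False using total by simp
  qed
  then obtain i where i: "i < D" "D * (\<Sum>u<a. card (S i u)) \<le> k * a" by blast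
  \<comment> \<open>Only one colour is possible here, whichever member of the class is played. As no
    \<open>S i u\<close> is empty, every other vertex contributes at least 2 to the sum of
    sizes.\<close>
  define W where "W = {u. u < a \<and> card (S i u) = 1}"
  define col where "col u = the_elem (S i u)" for u
  have col: "clr i x w = col w" if "x \<in> C i" "w \<in> W" for x w
  proof -
    have "clr i x w \<in> S i w" using that(1) by (auto simp: S_def)
    moreover have "is_singleton (S i w)" using that(2) by (simp add: W_def is_singleton_altdef)
    ultimately show ?thesis unfolding col_def by (metis is_singleton_the_elem singletonD)
  qed
  have "2 \<le> card (S i u) + of_bool (u \<in> W)" if "u < a" for u
  proof -
    have "card (S i u) > 0" using finC rep[of i] by (auto simp: S_def card_gt_0_iff)
    then show ?thesis using that by (auto simp: W_def)
  qed
  then have "(\<Sum>u<a. 2) \<le> (\<Sum>u<a. card (S i u) + of_bool (u \<in> W))"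
    by (intro sum_mono) auto
  also have "\<dots> = (\<Sum>u<a. card (S i u)) + card W"
  proof -
    have "(\<Sum>u<a. of_bool (u \<in> W)) = card ({..<a} \<inter> W)"
      by (simp add: of_bool_def sum.If_cases)
    also have "{..<a} \<inter> W = W" by (auto simp: W_def)
    finally show ?thesis by (simp add: sum.distrib)
  qed
  finally have "D * (2 * a) \<le> D * ((\<Sum>u<a. card (S i u)) + card W)"
    by (intro mult_le_mono2) (simp add: mult.commute)
  then have "2 * D * a \<le> D * card W + k * a"
    using i(2) by (simp add: algebra_simps)
  moreover have "conf x w \<noteq> conf x w'"
    if "x \<in> C i" "w \<in> W" "w' \<in> W" "w \<noteq> w'" "col w = col w'" for x w w'
    using clr_star[of x i w w'] col[OF that(1)] that i(1) by (auto simp: W_def)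
  moreover have "col ` W \<subseteq> {1..k}"
    using col[OF rep] clr_range[OF rep] i(1) by (force simp: W_def)
  ultimately show thesis
    using that[of "C i" W col] CF ms[of i] by (auto simp: C_def W_def)
qed

subsection \<open>Gadgets and the space bound for vertex arrivals\<close>

abbreviation slots :: "nat \<Rightarrow> nat \<Rightarrow> (nat \<times> nat) set" where
  "slots R D \<equiv> {..<R} \<times> {..<D}"

text \<open>Each of the \<open>g\<close> gadgets places \<open>R * D\<close> vertices into
  \<open>R\<close> centres with \<open>D\<close> places each. Both sides have the same size, so
  these injections are bijections.\<close>

definition configurations :: "nat \<Rightarrow> nat \<Rightarrow> nat \<Rightarrow> (nat \<Rightarrow> nat \<Rightarrow> nat \<times> nat) set" where
  "configurations g R D = (\<Pi>\<^sub>E h\<in>{..<g}. injections {..<R * D} (slots R D))"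

text \<open>The quotient names the gadget and the remainder the position in it; of the place, only
  the centre coordinate reaches the graph.\<close>

definition centre :: "nat \<Rightarrow> nat \<Rightarrow> (nat \<Rightarrow> nat \<Rightarrow> nat \<times> nat) \<Rightarrow> nat \<Rightarrow> nat" where
  "centre R D F u = (u div (R * D)) * R + fst (F (u div (R * D)) (u mod (R * D)))"

lemma card_configurations: "card (configurations g R D) = fact (R * D) ^ g"
  by (simp add: configurations_def card_PiE card_injections card_cartesian_product)

lemma finite_configurations: "finite (configurations g R D)"
  unfolding configurations_def by (intro finite_PiE finite_injections) auto

text \<open>Vertices with a common centre lie in the same gadget and hold places with different
  second coordinates, of which there are \<open>D\<close>.\<close>

lemma star_packing_centre:
  assumes F: "F \<in> configurations g R D"
  shows "star_packing (g * (R * D)) (g * R) D (centre R D F)"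
proof -
  define P where "P = R * D"
  have slot: "u div P < g \<and> F (u div P) (u mod P) \<in> slots R D \<and> inj_on (F (u div P)) {..<P} \<and> u mod P < P"
    if "u < g * P" for u
  proof -
    have "P > 0" using that by (cases "P = 0") auto
    moreover have "u div P < g" using that by (rule less_mult_imp_div_less)
    ultimately show ?thesis
      using F unfolding configurations_def injections_def P_def[symmetric]
      by (metis (no_types, lifting) PiE_mem lessThan_iff mem_Collect_eq mod_less_divisor)
  qed
  have fstR: "fst (F (u div P) (u mod P)) < R" and sndD: "snd (F (u div P) (u mod P)) < D"
    if "u < g * P" for u
    using slot[OF that] by (auto simp: mem_Times_iff)
  have "centre R D F u < g * R" if "u < g * P" for u
  proof -
    have "centre R D F u < (u div P + 1) * R"
      using fstR[OF that] by (simp add: centre_def P_def)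
    also have "\<dots> \<le> g * R" using slot[OF that] by (intro mult_le_mono1) auto
    finally show ?thesis .
  qed
  moreover have "card {u. u < g * P \<and> centre R D F u = j} \<le> D" for j
  proof -
    let ?U = "{u. u < g * P \<and> centre R D F u = j}"
    have u: "u div P = j div R \<and> fst (F (u div P) (u mod P)) = j mod R" if "u \<in> ?U" for u
      using that fstR[of u] by (auto simp: centre_def P_def div_mult_add_less)
    have "inj_on (\<lambda>u. snd (F (u div P) (u mod P))) ?U"
    proof (rule inj_onI)
      fix u v assume uv: "u \<in> ?U" "v \<in> ?U"
        and eq: "snd (F (u div P) (u mod P)) = snd (F (v div P) (v mod P))"
      have d: "u div P = v div P" using u[OF uv(1)] u[OF uv(2)] by simp
      have "F (u div P) (u mod P) = F (u div P) (v mod P)"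
        using u[OF uv(1)] u[OF uv(2)] eq d by (metis prod.expand)
      then have "u mod P = v mod P"
        using slot[of u] slot[of v] uv by (auto dest: inj_onD)
      with d show "u = v" by (metis div_mult_mod_eq)
    qed
    then have "card ?U \<le> card {..<D}"
      by (rule card_inj_on_le) (use sndD in auto)
    then show ?thesis by simp
  qed
  ultimately show ?thesis by (simp add: star_packing_def P_def)
qed

text \<open>Gadgets are filled independently, so the bounds multiply and the exponents add up. Per
  gadget, \<open>k\<close> forced vertices are given up before pairing and at most 7 to
  rounding.\<close>

lemma card_separated_configurations:
  assumes R: "0 < R" "2 \<le> D"
    and C: "C \<subseteq> configurations g R D" and W: "W \<subseteq> {..<g * (R * D)}" and col: "col ` W \<subseteq> {1..k}"
    and sep: "\<And>F w w'. F \<in> C \<Longrightarrow> w \<in> W \<Longrightarrow> w' \<in> W \<Longrightarrow> w \<noteq> w' \<Longrightarrow> col w = col w' \<Longrightarrow>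
                centre R D F w \<noteq> centre R D F w'"
  obtains t where "real (card C) \<le> (1 - 1 / (4 * real R)) ^ t * fact (R * D) ^ g"
    "card W \<le> 8 * t + g * (k + 7)"
proof -
  define P where "P = R * D"
  have "P > 0" and PR: "2 * R \<le> P" using R by (auto simp: P_def)
  define V where "V h = {x. x < P \<and> h * P + x \<in> W}" for h
  \<comment> \<open>A step uses two vertices, yet only an eighth of the surplus is taken: with
    \<open>card (V h) \<le> P\<close> and \<open>2 * R \<le> P\<close> this ensures
    \<open>4 * R + 6 * t h \<le> 3 * P\<close>, enough for
    \<open>card_separating_le\<close>.\<close>
  define t where "t h = (card (V h) - k) div 8" for h
  define S where "S h = separating fst (V h) (\<lambda>x. col (h * P + x)) {..<P} (slots R D)" for h
  define q where "q = 1 - 1 / (4 * real R)"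
  have V_le: "card (V h) \<le> P" for h
    using card_mono[of "{..<P}" "V h"] by (auto simp: V_def)
  have S: "real (card (S h)) \<le> q ^ t h * fact P" for h
  proof -
    have "real (card (S h)) \<le> (1 - 1 / (4 * real (card {..<R}))) ^ t h * fact (card (slots R D))"
      unfolding S_def
    proof (rule card_separating_le[where K = "{1..k}"])
      show "(\<lambda>x. col (h * P + x)) ` V h \<subseteq> {1..k}" using col by (auto simp: V_def)
      \<comment> \<open>Positivity of \<open>t h\<close> excludes a truncated difference
        \<open>card (V h) - k\<close>.\<close>
      show "card {1..k} + 2 * t h \<le> card (V h)" if "t h > 0"
        using that unfolding t_def by simp
      show "4 * card {..<R} + 6 * t h \<le> 3 * card (slots R D) + 6"
        using V_le[of h] PR by (simp add: t_def card_cartesian_product P_def[symmetric])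
    qed (use R in \<open>auto simp: V_def P_def card_cartesian_product\<close>)
    then show ?thesis by (simp add: q_def P_def card_cartesian_product)
  qed
  have "C \<subseteq> Pi\<^sub>E {..<g} S"
  proof
    fix F assume F: "F \<in> C"
    then have conf: "F \<in> (\<Pi>\<^sub>E h\<in>{..<g}. injections {..<P} (slots R D))"
      using C by (auto simp: configurations_def P_def)
    show "F \<in> Pi\<^sub>E {..<g} S"
    proof (rule PiE_I)
      fix h assume h: "h \<in> {..<g}"
      have cent: "centre R D F (h * P + x) = h * R + fst (F h x)" if "x < P" for x
        using that by (simp add: centre_def P_def[symmetric] div_mult_add_less mod_mult_add_less)
      have "fst (F h w) \<noteq> fst (F h w')"
        if "w \<in> V h" "w' \<in> V h" "w \<noteq> w'" "col (h * P + w) = col (h * P + w')" for w w'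
        using sep[OF F, of "h * P + w" "h * P + w'"] that cent by (auto simp: V_def)
      moreover have "F h \<in> injections {..<P} (slots R D)" using conf h by auto
      ultimately show "F h \<in> S h"
        by (auto simp: S_def separating_def)
    qed (use conf in \<open>auto simp: PiE_def extensional_def\<close>)
  qed
  moreover have "finite (S h)" for h
    by (rule finite_subset[OF _ finite_injections[of "{..<P}" "slots R D"]])
       (auto simp: S_def separating_def)
  ultimately have "card C \<le> card (Pi\<^sub>E {..<g} S)"
    by (intro card_mono finite_PiE) auto
  then have "real (card C) \<le> (\<Prod>h<g. real (card (S h)))"
    by (simp add: card_PiE flip: of_nat_prod)
  also have "\<dots> \<le> (\<Prod>h<g. q ^ t h * fact P)"
    by (rule prod_mono) (use S in auto)
  also have "\<dots> = q ^ (\<Sum>h<g. t h) * fact P ^ g"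
    by (simp add: prod.distrib power_sum)
  finally have "real (card C) \<le> q ^ (\<Sum>h<g. t h) * fact P ^ g" .
  moreover have "card W \<le> 8 * (\<Sum>h<g. t h) + g * (k + 7)"
  proof -
    have "W = (\<Union>h<g. (\<lambda>x. h * P + x) ` V h)"
    proof (intro equalityI subsetI)
      fix w assume w: "w \<in> W"
      then have "w < g * P" using W by (auto simp: P_def)
      then have "w div P < g" by (rule less_mult_imp_div_less)
      moreover have "w mod P \<in> V (w div P)" using w \<open>P > 0\<close> by (simp add: V_def)
      moreover have "w = w div P * P + w mod P" by simp
      ultimately show "w \<in> (\<Union>h<g. (\<lambda>x. h * P + x) ` V h)" by blast
    qed (auto simp: V_def)
    then have "card W \<le> (\<Sum>h<g. card ((\<lambda>x. h * P + x) ` V h))"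
      using card_UN_le[of "{..<g}"] by (metis finite_lessThan)
    also have "\<dots> \<le> (\<Sum>h<g. 8 * t h + (k + 7))"
    proof (rule sum_mono)
      fix h
      have "card ((\<lambda>x. h * P + x) ` V h) \<le> card (V h)"
        by (rule card_image_le) (simp add: V_def)
      then show "card ((\<lambda>x. h * P + x) ` V h) \<le> 8 * t h + (k + 7)"
        unfolding t_def by linarith
    qed
    finally show ?thesis by (simp add: sum.distrib sum_distrib_left)
  qed
  ultimately show thesis
    using that by (simp add: q_def P_def)
qed

lemma vertex_arrival_space:
  fixes \<beta> :: real
  assumes \<beta>: "1 < \<beta>" "\<beta> < 2" and D: "2 \<le> D" "real D \<le> real n * (2 - \<beta>) / (32 * \<beta>)"
    and alg: "vertex_arrival_coloring_algorithm n D (nat \<lfloor>\<beta> * real D\<rfloor>) A" "uses_space A s"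
  shows "(2 - \<beta>) ^ 3 * real n / 5184 \<le> real s"
proof -
  define e where "e = 2 - \<beta>"
  have e: "0 < e" "e < 1" using \<beta> by (auto simp: e_def)
  define k where "k = nat \<lfloor>\<beta> * real D\<rfloor>"
  have k: "real k \<le> \<beta> * real D" using \<beta> by (simp add: k_def)
  \<comment> \<open>With \<open>e * R \<ge> 8\<close> a gadget has on average at least
    \<open>8 * D\<close> forced vertices, more than the loss \<open>k + 7\<close>, which is at most
    \<open>11/2 * D\<close>.\<close>
  define R where "R = nat \<lceil>8 / e\<rceil>"
  have R8: "8 / e \<le> real R" using e by (simp add: R_def)
  have "real R \<le> 8 / e + 1" using e by (simp add: R_def)
  also have "\<dots> \<le> 9 / e" using e by (simp add: field_simps)
  finally have R9: "real R \<le> 9 / e" .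
  have "0 < 8 / e" using e by simp
  with R8 have R0: "0 < R" by (cases "R = 0") auto
  \<comment> \<open>The vertices consumed by a gadget: \<open>R * D\<close> distributed ones, and
    \<open>R\<close> fresh centres in each of \<open>D\<close> rounds.\<close>
  define M where "M = 2 * (R * D)"
  have "M > 0" using R0 D by (simp add: M_def)
  define g where "g = n div M"
  define a where "a = g * (R * D)"
  \<comment> \<open>The upper bound on \<open>D\<close> enters here: at least one gadget
    fits.\<close>
  have "real M = 2 * real R * real D" by (simp add: M_def)
  also have "\<dots> \<le> 2 * (9 / e) * (real n * e / (32 * \<beta>))"
    using R9 D e by (intro mult_mono) (auto simp: e_def)
  also have "\<dots> \<le> real n"
    using e \<beta> mult_right_mono[of 9 "16 * \<beta>" "real n"] by (simp add: field_simps)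
  finally have "M \<le> n" by simp
  then have g0: "g > 0" using \<open>M > 0\<close> by (simp add: g_def div_greater_zero_iff)
  have "n = g * M + n mod M" by (simp add: g_def)
  moreover have "n mod M < M" using \<open>M > 0\<close> by simp
  moreover have "M \<le> g * M" using g0 by simp
  ultimately have n: "n \<le> 2 * (g * M)" and aM: "g * M \<le> n" by linarith+
  have aD: "a + D * (g * R) \<le> n" using aM by (simp add: a_def M_def algebra_simps)
  have a0: "0 < a" using g0 R0 D by (simp add: a_def)
  obtain C W col where C: "C \<subseteq> configurations g R D" "card (configurations g R D) \<le> 2 ^ s * card C"
    and W: "W \<subseteq> {..<a}" "col ` W \<subseteq> {1..k}" "2 * D * a \<le> D * card W + k * a"
    and sep: "\<And>F w w'. F \<in> C \<Longrightarrow> w \<in> W \<Longrightarrow> w' \<in> W \<Longrightarrow> w \<noteq> w' \<Longrightarrow> col w = col w' \<Longrightarrow>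
                centre R D F w \<noteq> centre R D F w'"
  proof (rule popular_class_with_forced_colours[OF alg[folded k_def] finite_configurations])
    show "configurations g R D \<noteq> {}"
      using card_configurations[of g R D] by (metis card.empty fact_nonzero power_not_zero)
    show "star_packing a (g * R) D (centre R D F)" if "F \<in> configurations g R D" for F
      using star_packing_centre[OF that] by (simp add: a_def)
  qed (use aD a0 D in auto)
  obtain t where t: "real (card C) \<le> (1 - 1 / (4 * real R)) ^ t * fact (R * D) ^ g"
      "card W \<le> 8 * t + g * (k + 7)"
    using card_separated_configurations[OF R0 D(1) C(1) W(1)[unfolded a_def] W(2) sep] by blast
  have t_ge: "real g * real D / 4 \<le> real t"
  proof -
    have "2 * real D * real a \<le> real D * real (card W) + real k * real a"
      using of_nat_mono[OF W(3), where 'a = real] by simp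
    also have "\<dots> \<le> real D * real (card W) + \<beta> * real D * real a"
      using k by (simp add: mult_right_mono)
    finally have "real D * (e * real a) \<le> real D * real (card W)"
      by (simp add: e_def algebra_simps)
    then have "e * real a \<le> real (card W)" using D by simp
    moreover have "8 * (real g * real D) \<le> e * real a"
    proof -
      have "8 \<le> e * real R" using R8 e by (simp add: field_simps)
      then have "8 * (real g * real D) \<le> e * real R * (real g * real D)"
        by (rule mult_right_mono) simp
      then show ?thesis by (simp add: a_def mult_ac)
    qed
    moreover have "real (card W) \<le> 8 * real t + real g * (real k + 7)"
      using of_nat_mono[OF t(2), where 'a = real] by simp
    \<comment> \<open>\<open>2 \<le> D\<close> turns the rounding loss 7 into
      \<open>7/2 * D\<close>. Altogether \<open>8 * t \<ge> 5/2 * g * D\<close>.\<close>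
    moreover have "real g * (real k + 7) \<le> real g * (2 * real D + 7 / 2 * real D)"
    proof (rule mult_left_mono)
      have "\<beta> * real D \<le> 2 * real D" using \<beta> by (intro mult_right_mono) auto
      then show "real k + 7 \<le> 2 * real D + 7 / 2 * real D" using k D(1) by linarith
    qed simp
    ultimately show ?thesis by (simp add: algebra_simps)
  qed
  have "(fact (R * D) :: real) ^ g \<le> 2 ^ s * real (card C)"
  proof -
    have "real (fact (R * D) ^ g) \<le> real (2 ^ s * card C)"
      using C(2) unfolding card_configurations by (rule of_nat_mono)
    then show ?thesis by simp
  qed
  also have "\<dots> \<le> 2 ^ s * ((1 - 1 / (4 * real R)) ^ t * fact (R * D) ^ g)"
    using t(1) by (intro mult_left_mono) auto
  finally have "1 * (fact (R * D) :: real) ^ g \<le> 2 ^ s * (1 - 1 / (4 * real R)) ^ t * fact (R * D) ^ g"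
    by (simp add: mult.assoc)
  then have "1 \<le> 2 ^ s * (1 - 1 / (4 * real R)) ^ t"
    by (subst (asm) mult_le_cancel_right_pos) auto
  \<comment> \<open>Relaxing the base 2 to Euler's number reduces the inequality to a comparison of
    exponents.\<close>
  also have "\<dots> \<le> exp 1 ^ s * exp (- 1 / (4 * real R)) ^ t"
  proof (intro mult_mono power_mono zero_le_power)
    show "1 - 1 / (4 * real R) \<le> exp (- 1 / (4 * real R))"
      using exp_ge_add_one_self[of "- 1 / (4 * real R)"] by simp
    show "0 \<le> 1 - 1 / (4 * real R)" using R0 by simp
    show "2 \<le> exp (1 :: real)" using exp_ge_add_one_self[of 1] by simp
  qed (use R0 in auto)
  also have "\<dots> = exp (real s * 1) * exp (real t * (- 1 / (4 * real R)))"
    by (simp only: exp_of_nat_mult)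
  also have "\<dots> = exp (real s - real t / (4 * real R))"
    by (simp add: mult_exp_exp)
  finally have "real t / (4 * real R) \<le> real s" by simp
  \<comment> \<open>The constant is 81 times 64: \<open>n \<le> 2 * g * M \<le> 16 * R * t\<close>,
    which is 64 times the square of \<open>R\<close> times the lower bound for \<open>s\<close>, and
    \<open>e * R \<le> 9\<close>, \<open>e \<le> 1\<close>.\<close>
  moreover have "e ^ 3 * real n / 5184 \<le> real t / (4 * real R)"
  proof -
    have "real n \<le> real (2 * (g * M))"
      using n by (rule of_nat_mono)
    also have "\<dots> = 4 * real g * real R * real D"
      by (simp add: M_def)
    also have "\<dots> \<le> 16 * real R * real t"
      using t_ge mult_left_mono[OF t_ge, of "16 * real R"] by (simp add: mult_ac)
    finally have "e ^ 3 * real n \<le> e ^ 3 * (16 * real R * real t)"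
      using e by (intro mult_left_mono) auto
    also have "\<dots> = (e * real R)\<^sup>2 * e * 64 * (real t / (4 * real R))"
      using R0 by (simp add: field_simps power2_eq_square power3_eq_cube)
    also have "\<dots> \<le> 9\<^sup>2 * 1 * 64 * (real t / (4 * real R))"
      using R9 e by (intro mult_mono power_mono) (auto simp: field_simps)
    finally show ?thesis by simp
  qed
  ultimately show ?thesis by (simp add: e_def)
qed

subsection \<open>Reduction from edge arrivals to vertex arrivals\<close>

definition incident_edges :: "nat \<times> nat set \<Rightarrow> edge list" where
  "incident_edges vN = map (\<lambda>u. {u, fst vN}) (sorted_list_of_set (snd vN))"

text \<open>All edges of a token are read within one step, so the intermediate states are never
  stored and the space stays that of \<open>A\<close>. Outside the neighbour set the output is an
  arbitrary \<open>the None\<close>.\<close>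

definition batched :: "(edge, nat) online_algorithm \<Rightarrow> (nat \<times> nat set, nat \<Rightarrow> nat) online_algorithm" where
  "batched A = \<lparr>init = init A, step = (\<lambda>m vN. (mem_after A m (incident_edges vN),
     \<lambda>u. the (map_of (zip (sorted_list_of_set (snd vN)) (outputs_from A m (incident_edges vN))) u)))\<rparr>"

lemma uses_space_batched: "uses_space A s \<Longrightarrow> uses_space (batched A) s"
  using length_mem_after[of A s] by (auto simp: uses_space_def[of "batched A"] batched_def)
    (simp add: uses_space_def)

lemma outputs_batched:
  assumes "((v, N), \<chi>) \<in> set (zip vs (outputs_from (batched A) m vs))" "u \<in> N" "finite N"
  shows "({u, v}, \<chi> u) \<in> set (zip (concat (map incident_edges vs))
            (outputs_from A m (concat (map incident_edges vs))))"
  using assms(1)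
proof (induction vs arbitrary: m)
  case (Cons x vs)
  show ?case
  proof (cases "((v, N), \<chi>) \<in> set (zip vs (outputs_from (batched A) (mem_after A m (incident_edges x)) vs))")
    case True
    then show ?thesis using Cons.IH by (auto simp: outputs_from_append)
  next
    case False
    let ?l = "sorted_list_of_set N" and ?o = "outputs_from A m (incident_edges (v, N))"
    from False have x: "x = (v, N)" and \<chi>: "\<chi> = (\<lambda>u. the (map_of (zip ?l ?o) u))"
      using Cons.prems by (auto simp: batched_def)
    obtain j where j: "j < length ?l" "?l ! j = u"
      using assms(2,3) by (metis in_set_conv_nth set_sorted_list_of_set)
    have len: "length ?l = length ?o" by (simp add: incident_edges_def)
    then have "\<chi> u = ?o ! j"
      using map_of_zip_nth[of ?l ?o j] j \<chi> by simp
    moreover have "incident_edges (v, N) ! j = {u, v}"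
      using j by (simp add: incident_edges_def)
    ultimately have "({u, v}, \<chi> u) \<in> set (zip (incident_edges (v, N)) ?o)"
      using j len unfolding set_zip by (auto simp: incident_edges_def intro!: exI[of _ j])
    then show ?thesis by (simp add: x outputs_from_append)
  qed
qed simp

text \<open>Every edge is listed at its later endpoint. That vertex is new, so it lies in all edges
  of its own token and in no earlier edge.\<close>

lemma distinct_incident_edges:
  assumes "distinct (map fst vs)" "\<And>i. i < length vs \<Longrightarrow> snd (vs ! i) \<subseteq> set (map fst (take i vs))"
  shows "distinct (concat (map incident_edges vs)) \<and>
    (\<forall>e \<in> set (concat (map incident_edges vs)). e \<subseteq> set (map fst vs) \<and> card e = 2) \<and>
    set (concat (map incident_edges vs)) = vertex_stream_edges vs \<and> (\<forall>x\<in>set vs. finite (snd x))"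
  using assms
proof (induction vs rule: rev_induct)
  case Nil
  then show ?case by (simp add: vertex_stream_edges_def)
next
  case (snoc x vs)
  obtain v N where x: "x = (v, N)" by fastforce
  have N: "N \<subseteq> set (map fst vs)" using snoc.prems(2)[of "length vs"] x by simp
  then have "finite N" using finite_subset by blast
  have v: "v \<notin> set (map fst vs)" using snoc.prems(1) x by auto
  have "snd (vs ! i) \<subseteq> set (map fst (take i vs))" if "i < length vs" for i
    using snoc.prems(2)[of i] that by (simp add: nth_append)
  moreover have "distinct (map fst vs)" using snoc.prems(1) by simp
  ultimately have IH: "distinct (concat (map incident_edges vs))"
      "\<And>e. e \<in> set (concat (map incident_edges vs)) \<Longrightarrow> e \<subseteq> set (map fst vs) \<and> card e = 2"
      "set (concat (map incident_edges vs)) = vertex_stream_edges vs" "\<forall>x\<in>set vs. finite (snd x)"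
    using snoc.IH by blast+
  have inc: "set (incident_edges x) = (\<lambda>u. {u, v}) ` N"
    using \<open>finite N\<close> by (simp add: incident_edges_def x)
  have "v \<notin> N" using N v by auto
  then have "inj_on (\<lambda>u. {u, v}) N" by (auto simp: inj_on_def doubleton_eq_iff)
  then have "distinct (incident_edges x)"
    using \<open>finite N\<close> by (simp add: incident_edges_def x distinct_map)
  moreover have "set (incident_edges x) \<inter> set (concat (map incident_edges vs)) = {}"
  proof -
    have "v \<in> e" if "e \<in> set (incident_edges x)" for e using that unfolding inc by blast
    then show ?thesis using IH(2) v by blast
  qed
  moreover have "e \<subseteq> set (map fst (vs @ [x])) \<and> card e = 2"
    if "e \<in> set (concat (map incident_edges (vs @ [x])))" for e
  proof (cases "e \<in> set (incident_edges x)")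
    case True
    then show ?thesis using N \<open>v \<notin> N\<close> unfolding inc by (auto simp: x card_insert_if)
  next
    case False
    then show ?thesis using IH(2)[of e] that by auto
  qed
  moreover have "vertex_stream_edges (vs @ [x]) = vertex_stream_edges vs \<union> set (incident_edges x)"
    unfolding inc vertex_stream_edges_def by (auto simp: x)
  moreover have "\<forall>y\<in>set (vs @ [x]). finite (snd y)"
    using IH(4) \<open>finite N\<close> by (simp add: x)
  moreover have "set (concat (map incident_edges (vs @ [x]))) = vertex_stream_edges (vs @ [x])"
    using calculation(4) IH(3) by (simp add: Un_commute)
  moreover have "distinct (concat (map incident_edges (vs @ [x])))"
    using calculation(1,2) IH(1) by (simp add: Int_commute)
  ultimately show ?case by blast
qed

lemma proper_edge_coloring_mono:
  "proper_edge_coloring k C \<Longrightarrow> B \<subseteq> C \<Longrightarrow> proper_edge_coloring k B"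
  unfolding proper_edge_coloring_def by blast

lemma vertex_arrival_batched:
  assumes "edge_arrival_coloring_algorithm n D k A"
  shows "vertex_arrival_coloring_algorithm n D k (batched A)"
  unfolding vertex_arrival_coloring_algorithm_def
proof (intro allI impI)
  fix vs assume vs: "vertex_stream n D vs"
  let ?es = "concat (map incident_edges vs)"
  let ?C = "{({u, v}, \<chi> u) | u v N \<chi>. ((v, N), \<chi>) \<in> set (zip vs (outputs (batched A) vs)) \<and> u \<in> N}"
  have fst_vs: "set (map fst vs) = {..<n}" and deg: "max_degree n (vertex_stream_edges vs) = D"
    using vs by (simp_all add: vertex_stream_def)
  have "distinct (map fst vs)" "\<And>i. i < length vs \<Longrightarrow> snd (vs ! i) \<subseteq> set (map fst (take i vs))"
    using vs unfolding vertex_stream_def by blast+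
  note es = distinct_incident_edges[OF this, unfolded fst_vs]
  have "simple_graph n (set ?es)"
    unfolding simple_graph_def using es by blast
  then have "edge_stream n D ?es"
    unfolding edge_stream_def using es deg by metis
  then have proper: "proper_edge_coloring k (set (zip ?es (outputs A ?es)))"
    using assms by (auto simp: edge_arrival_coloring_algorithm_def)
  have "?C \<subseteq> set (zip ?es (outputs A ?es))"
  proof
    fix z assume "z \<in> ?C"
    then obtain u v N \<chi> where z: "z = ({u, v}, \<chi> u)" "u \<in> N"
        "((v, N), \<chi>) \<in> set (zip vs (outputs (batched A) vs))"
      by blast
    moreover have "finite N" using set_zip_leftD[OF z(3)] es by force
    ultimately show "z \<in> set (zip ?es (outputs A ?es))"
      using outputs_batched[of v N \<chi> vs A "init A" u] by (simp add: outputs_def batched_def)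
  qed
  then show "proper_edge_coloring k ?C"
    by (rule proper_edge_coloring_mono[OF proper])
qed

text \<open>The bound starts at \<Delta> = 2: for \<Delta> = 1 the floor leaves a single colour, and
  giving it to every edge of a matching takes no memory.\<close>

theorem theorem5p2:
  shows "\<exists>c::real. c > 0 \<and>
    (\<forall>(\<beta>::real) (n::nat) (\<Delta>::nat).
       1 < \<beta> \<and> \<beta> < 2 \<and> 2 \<le> \<Delta> \<and> real \<Delta> \<le> real n * (2 - \<beta>) / (32 * \<beta>) \<longrightarrow>
       (\<forall>A s. edge_arrival_coloring_algorithm n \<Delta> (nat \<lfloor>\<beta> * real \<Delta>\<rfloor>) A \<and> uses_space A s
          \<longrightarrow> c * (2 - \<beta>) ^ 3 * real n \<le> real s) \<and>
       (\<forall>A s. vertex_arrival_coloring_algorithm n \<Delta> (nat \<lfloor>\<beta> * real \<Delta>\<rfloor>) A \<and> uses_space A s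
          \<longrightarrow> c * (2 - \<beta>) ^ 3 * real n \<le> real s))"
proof (intro exI[of _ "1 / 5184"] conjI allI impI)
  fix \<beta> :: real and n \<Delta> s :: nat and A :: "(nat \<times> nat set, nat \<Rightarrow> nat) online_algorithm"
  assume "1 < \<beta> \<and> \<beta> < 2 \<and> 2 \<le> \<Delta> \<and> real \<Delta> \<le> real n * (2 - \<beta>) / (32 * \<beta>)"
    and "vertex_arrival_coloring_algorithm n \<Delta> (nat \<lfloor>\<beta> * real \<Delta>\<rfloor>) A \<and> uses_space A s"
  then show "1 / 5184 * (2 - \<beta>) ^ 3 * real n \<le> real s"
    using vertex_arrival_space[of \<beta> \<Delta> n A s] by simp
next
  fix \<beta> :: real and n \<Delta> s :: nat and A :: "(edge, nat) online_algorithm"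
  assume "1 < \<beta> \<and> \<beta> < 2 \<and> 2 \<le> \<Delta> \<and> real \<Delta> \<le> real n * (2 - \<beta>) / (32 * \<beta>)"
    and "edge_arrival_coloring_algorithm n \<Delta> (nat \<lfloor>\<beta> * real \<Delta>\<rfloor>) A \<and> uses_space A s"
  then show "1 / 5184 * (2 - \<beta>) ^ 3 * real n \<le> real s"
    using vertex_arrival_space[of \<beta> \<Delta> n "batched A" s] vertex_arrival_batched[of n \<Delta> _ A]
      uses_space_batched[of A s] by simp
qed simp

end
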